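(* Let $d>3$, let $H$ be an order $d$ complex Hadamard matrix and let $v\in\mathbb{C}$. Then $H(v)$ is a set of $d^2$ equiangular lines in $\mathbb{C}^d$ if and only if $d=8$, $H$ is equivalent to a real Hadamard matrix, and $v\in\{-1\pm 2i\}$.
   Context: An order $d$ complex Hadamard matrix is a $d\times d$ matrix $H$ with all entries in $\mathbb{C}$ of magnitude $1$ such that $HH^\dagger = dI_d$, where $H^\dagger$ is the conjugate transpose. If all entries lie in $\{1,-1\}$, $H$ is a real Hadamard matrix. Two complex Hadamard matrices $H,H'$ are equivalent if $H'=DPHP'D'$ for some diagonal unitary matrices $D,D'$ and permutation matrices $P,P'$. Regard the rows of $H$ as vectors in $\mathbb{C}^d$. For $j=1,\dots,d$ let $H_j(v)$ be the collection of $d$ vectors obtained by multiplying coordinate $j$ of each row of $H$ by $v$, and $H(v)=\bigcup_{j=1}^d H_j(v)$, a collection of $d^2$ vectors. Using the standard Hermitian inner product, "$H(v)$ is a set of $d^2$ equiangular lines" means the $d^2$ vectors span $d^2$ distinct lines through the origin and $|\langle\mathbf{x},\mathbf{y}\rangle|$ is the same constant for every pair of distinct vectors $\mathbf{x},\mathbf{y}$ of $H(v)$. *)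

theory Defs
  imports Complex_Main "Jordan_Normal_Form.Schur_Decomposition"
begin

definition complex_hadamard :: "nat \<Rightarrow> complex mat \<Rightarrow> bool" where
  "complex_hadamard d H \<longleftrightarrow>
     H \<in> carrier_mat d d \<and>
     (\<forall>i<d. \<forall>j<d. cmod (H $$ (i, j)) = 1) \<and>
     H * mat_adjoint H = of_nat d \<cdot>\<^sub>m 1\<^sub>m d"

definition real_hadamard :: "nat \<Rightarrow> complex mat \<Rightarrow> bool" where
  "real_hadamard d H \<longleftrightarrow>
     complex_hadamard d H \<and> (\<forall>i<d. \<forall>j<d. H $$ (i, j) \<in> {1, -1})"

definition unitary_mat :: "nat \<Rightarrow> complex mat \<Rightarrow> bool" where
  "unitary_mat d U \<longleftrightarrow>
     U \<in> carrier_mat d d \<and> U * mat_adjoint U = 1\<^sub>m d \<and> mat_adjoint U * U = 1\<^sub>m d"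

definition permutation_mat :: "nat \<Rightarrow> complex mat \<Rightarrow> bool" where
  "permutation_mat d P \<longleftrightarrow>
     (\<exists>\<sigma>. \<sigma> permutes {0..<d} \<and> P = mat d d (\<lambda>(i, j). if j = \<sigma> i then 1 else 0))"

definition hadamard_equivalent :: "nat \<Rightarrow> complex mat \<Rightarrow> complex mat \<Rightarrow> bool" where
  "hadamard_equivalent d H H' \<longleftrightarrow>
     complex_hadamard d H \<and> complex_hadamard d H' \<and>
     (\<exists>D D' P P'.
        diagonal_mat D \<and> unitary_mat d D \<and> diagonal_mat D' \<and> unitary_mat d D' \<and>
        permutation_mat d P \<and> permutation_mat d P' \<and>
        H' = D * P * H * P' * D')"

definition scale_coord :: "nat \<Rightarrow> complex \<Rightarrow> complex vec \<Rightarrow> complex vec" where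
  "scale_coord j v x = vec (dim_vec x) (\<lambda>k. if k = j then v * x $ k else x $ k)"

text \<open>Coordinates and rows are indexed from \<open>0\<close> to \<open>d - 1\<close>.  The collections \<open>H\<^sub>j(v)\<close> and
  \<open>H(v)\<close> are rendered as sets; coinciding vectors are ruled out by the cardinality condition in
  \<open>equiangular_lines\<close> below.\<close>

definition hadamard_coord_vectors :: "complex mat \<Rightarrow> nat \<Rightarrow> complex \<Rightarrow> complex vec set" where
  "hadamard_coord_vectors H j v = {scale_coord j v (row H i) | i. i < dim_row H}"

definition hadamard_vectors :: "complex mat \<Rightarrow> complex \<Rightarrow> complex vec set" where
  "hadamard_vectors H v = (\<Union>j<dim_col H. hadamard_coord_vectors H j v)"

definition complex_line :: "complex vec \<Rightarrow> complex vec set" where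
  "complex_line x = {a \<cdot>\<^sub>v x | a. True}"

text \<open>\<open>equiangular_lines d n S\<close>: \<open>S\<close> consists of \<open>n\<close> nonzero vectors of \<open>\<complex>\<^sup>d\<close> spanning \<open>n\<close> distinct
  lines, and \<open>\<bar>\<langle>x, y\<rangle>\<bar>\<close> is the same for all pairs of distinct vectors of \<open>S\<close>.\<close>

definition equiangular_lines :: "nat \<Rightarrow> nat \<Rightarrow> complex vec set \<Rightarrow> bool" where
  "equiangular_lines d n S \<longleftrightarrow>
     S \<subseteq> carrier_vec d \<and> finite S \<and> card S = n \<and>
     0\<^sub>v d \<notin> S \<and> inj_on complex_line S \<and>
     (\<exists>c. \<forall>x\<in>S. \<forall>y\<in>S. x \<noteq> y \<longrightarrow> cmod (x \<bullet>c y) = c)"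

end

(* Put w = v - 1 and, for two distinct rows i and i', let x_k be the quotient of their k-th entries.
   The three kinds of inner products between vectors of H(v) have moduli | |v|^2 - 1 |,
   | d - 2 + 2 Re v | and |w x_j + cnj w x_j'|, and the square of the last is
   2|w|^2 + 2 Re (w^2 z) with z = x_j cnj x_j'. Interchanging j and j' conjugates z, so equiangularity
   forces Im (w^2) Im z = 0 and Re (w^2) Re z constant. If w^2 were real, the d > 3 unit complex
   numbers x_k, which sum to 0, would have equal pairwise real inner products, which the plane does
   not allow. So every z is 1 or -1, which makes H equivalent to a real matrix; both signs occur,
   so w^2 is purely imaginary. Comparing the three moduli then gives w = -2 + 2i or -2 - 2i and
   d = 8. *)

theory Submission
  imports Defs
begin

section \<open>Hadamard matrices entrywise, and multiplication by diagonal and permutation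
  matrices\<close>

lemma complex_hadamard_iff:
  "complex_hadamard d H \<longleftrightarrow> H \<in> carrier_mat d d \<and>
     (\<forall>i<d. \<forall>j<d. cmod (H $$ (i, j)) = 1) \<and>
     (\<forall>i<d. \<forall>i'<d. (\<Sum>k<d. H $$ (i, k) * cnj (H $$ (i', k))) = (if i = i' then of_nat d else 0))"
proof (cases "H \<in> carrier_mat d d")
  case True
  have "H * mat_adjoint H = of_nat d \<cdot>\<^sub>m 1\<^sub>m d \<longleftrightarrow>
      (\<forall>i<d. \<forall>i'<d. (\<Sum>k<d. H $$ (i, k) * cnj (H $$ (i', k))) = (if i = i' then of_nat d else 0))"
    using True
    by (auto simp: mat_eq_iff mat_adjoint_def scalar_prod_def mat_of_rows_def lessThan_atLeast0 cong: if_cong)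
  then show ?thesis
    using True by (simp add: complex_hadamard_def)
qed (simp add: complex_hadamard_def)

lemma diagonal_mat_mult_left:
  assumes "diagonal_mat D" "D \<in> carrier_mat d d" "A \<in> carrier_mat d n" "i < d" "j < n"
  shows "(D * A) $$ (i, j) = D $$ (i, i) * A $$ (i, j)"
proof -
  have "(D * A) $$ (i, j) = (\<Sum>k\<in>{0..<d}. D $$ (i, k) * A $$ (k, j))"
    using assms by (simp add: scalar_prod_def)
  also have "\<dots> = (\<Sum>k\<in>{0..<d}. if k = i then D $$ (i, i) * A $$ (i, j) else 0)"
    using assms by (intro sum.cong) (auto simp: diagonal_mat_def)
  finally show ?thesis
    using assms by simp
qed

lemma diagonal_mat_mult_right:
  assumes "diagonal_mat D" "D \<in> carrier_mat d d" "A \<in> carrier_mat n d" "i < n" "j < d"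
  shows "(A * D) $$ (i, j) = A $$ (i, j) * D $$ (j, j)"
proof -
  have "(A * D) $$ (i, j) = (\<Sum>k\<in>{0..<d}. A $$ (i, k) * D $$ (k, j))"
    using assms by (simp add: scalar_prod_def)
  also have "\<dots> = (\<Sum>k\<in>{0..<d}. if k = j then A $$ (i, j) * D $$ (j, j) else 0)"
    using assms by (intro sum.cong) (auto simp: diagonal_mat_def)
  finally show ?thesis
    using assms by simp
qed

lemma permutation_mat_mult_left:
  fixes A :: "complex mat"
  assumes "\<sigma> permutes {0..<d}" "A \<in> carrier_mat d n" "i < d" "j < n"
  shows "(mat d d (\<lambda>(i, j). if j = \<sigma> i then 1 else 0) * A) $$ (i, j) = A $$ (\<sigma> i, j)"
proof -
  have "\<sigma> i < d"
    using permutes_in_image[OF assms(1), of i] assms(3) by simp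
  then show ?thesis
    using assms by (simp add: scalar_prod_def if_distrib[of "\<lambda>x. x * _"] cong: if_cong)
qed

text \<open>The ones of the permutation matrix sit at the positions \<open>(j, \<sigma> j)\<close>,
  so multiplication from the right moves column \<open>j\<close> to position
  \<open>\<sigma> j\<close>. Reading the product at \<open>\<sigma> j\<close> avoids the inverse
  permutation.\<close>

lemma permutation_mat_mult_right:
  fixes A :: "complex mat"
  assumes "\<sigma> permutes {0..<d}" "A \<in> carrier_mat n d" "i < n" "j < d"
  shows "(A * mat d d (\<lambda>(i, j). if j = \<sigma> i then 1 else 0)) $$ (i, \<sigma> j) = A $$ (i, j)"
proof -
  have "\<sigma> j < d"
    using permutes_in_image[OF assms(1), of j] assms(4) by simp
  moreover have "\<sigma> j = \<sigma> k \<longleftrightarrow> j = k" for k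
    using permutes_inj[OF assms(1)] by (auto dest: injD)
  ultimately show ?thesis
    using assms by (simp add: scalar_prod_def if_distrib[of "\<lambda>x. _ * x"] cong: if_cong)
qed

lemma unitary_diagonal_entry:
  assumes "diagonal_mat D" "unitary_mat d D" "i < d"
  shows "D $$ (i, i) * cnj (D $$ (i, i)) = 1"
proof -
  have D: "D \<in> carrier_mat d d" and "D * mat_adjoint D = 1\<^sub>m d"
    using assms by (auto simp: unitary_mat_def)
  then have "(D * mat_adjoint D) $$ (i, i) = 1"
    using assms by simp
  then have "D $$ (i, i) * mat_adjoint D $$ (i, i) = 1"
    using D assms by (subst (asm) diagonal_mat_mult_left[of D d _ d]) (auto simp: mat_adjoint_def)
  then show ?thesis
    using D assms by (simp add: mat_adjoint_def mat_of_rows_def)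
qed

lemma diagonal_unitaryI:
  fixes f :: "nat \<Rightarrow> complex"
  assumes "\<And>i. i < d \<Longrightarrow> f i * cnj (f i) = 1"
  defines "D \<equiv> mat d d (\<lambda>(i, j). if i = j then f i else 0)"
  shows "diagonal_mat D" "unitary_mat d D"
proof -
  show diag: "diagonal_mat D"
    by (simp add: diagonal_mat_def D_def)
  define E where "E = mat d d (\<lambda>(i, j). if i = j then cnj (f i) else 0)"
  have adj: "mat_adjoint D = E"
    by (auto simp: mat_eq_iff mat_adjoint_def mat_of_rows_def D_def E_def)
  have carr: "D \<in> carrier_mat d d" "E \<in> carrier_mat d d"
    by (simp_all add: D_def E_def)
  moreover have "D * E = 1\<^sub>m d"
    using assms(1) carr diagonal_mat_mult_left[OF diag carr]
    by (intro eq_matI) (simp_all del: index_mult_mat(1), auto simp: D_def E_def)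
  moreover have "E * D = 1\<^sub>m d"
    using assms(1) carr diagonal_mat_mult_right[OF diag carr]
    by (intro eq_matI) (simp_all del: index_mult_mat(1), auto simp: D_def E_def mult.commute)
  ultimately show "unitary_mat d D"
    by (simp add: unitary_mat_def adj)
qed

lemma permutation_mat_one: "permutation_mat d (1\<^sub>m d)"
  unfolding permutation_mat_def
  by (rule exI[of _ id]) (auto simp: permutes_id mat_eq_iff)

section \<open>Row quotients, their cross ratios, and equivalence to a real Hadamard matrix\<close>

lemma mult_cnj_eq_1_iff: "z * cnj z = 1 \<longleftrightarrow> cmod z = 1"
  by (metis complex_norm_square mult.commute norm_ge_zero of_real_1 of_real_eq_iff power2_eq_1_iff
      one_power2 le_minus_one_simps(3))

text \<open>On unit complex numbers conjugation is inversion, so for a Hadamard matrix this product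
  is a quotient of two entries in one column. Orthogonality of distinct rows says that these
  quotients sum to 0.\<close>

definition row_quotient :: "complex mat \<Rightarrow> nat \<Rightarrow> nat \<Rightarrow> nat \<Rightarrow> complex" where
  "row_quotient H i i' k = H $$ (i, k) * cnj (H $$ (i', k))"

lemma norm_row_quotient:
  "complex_hadamard d H \<Longrightarrow> i < d \<Longrightarrow> i' < d \<Longrightarrow> k < d \<Longrightarrow> cmod (row_quotient H i i' k) = 1"
  by (simp add: row_quotient_def complex_hadamard_iff norm_mult)

lemma sum_row_quotient:
  "complex_hadamard d H \<Longrightarrow> i < d \<Longrightarrow> i' < d \<Longrightarrow>
     (\<Sum>k<d. row_quotient H i i' k) = (if i = i' then of_nat d else 0)"
  by (simp add: row_quotient_def complex_hadamard_iff)

text \<open>The cross ratio of two rows and two columns is an invariant of equivalence up to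
  relabelling: each diagonal phase meets its own conjugate and cancels, and the permutations only
  rename rows and columns. It can thus be computed in \<open>K\<close>, whose entries are
  signs.\<close>

lemma cross_ratio_real_if_equivalent:
  assumes "real_hadamard d K" "hadamard_equivalent d H K"
    and "i < d" "i' < d" "j < d" "j' < d"
  shows "row_quotient H i i' j * cnj (row_quotient H i i' j') \<in> {1, -1}"
proof -
  obtain D D' P P' where D: "diagonal_mat D" "unitary_mat d D" "diagonal_mat D'" "unitary_mat d D'"
    and P: "permutation_mat d P" "permutation_mat d P'" and K: "K = D * P * H * P' * D'"
    using assms(2) by (auto simp: hadamard_equivalent_def)
  obtain \<sigma> \<tau> where \<sigma>: "\<sigma> permutes {0..<d}" "P = mat d d (\<lambda>(i, j). if j = \<sigma> i then 1 else 0)"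
    and \<tau>: "\<tau> permutes {0..<d}" "P' = mat d d (\<lambda>(i, j). if j = \<tau> i then 1 else 0)"
    using P by (auto simp: permutation_mat_def)
  have carr: "D \<in> carrier_mat d d" "D' \<in> carrier_mat d d" "P \<in> carrier_mat d d"
      "P' \<in> carrier_mat d d" "H \<in> carrier_mat d d"
    using D assms \<sigma> \<tau> by (auto simp: unitary_mat_def hadamard_equivalent_def complex_hadamard_iff)
  have \<tau>_less: "\<tau> m < d" if "m < d" for m
    using permutes_in_image[OF \<tau>(1), of m] that by simp
  have K_entry: "K $$ (l, \<tau> m) = D $$ (l, l) * H $$ (\<sigma> l, m) * D' $$ (\<tau> m, \<tau> m)"
    if "l < d" "m < d" for l m
  proof -
    have "K $$ (l, \<tau> m) = (D * P * H * P') $$ (l, \<tau> m) * D' $$ (\<tau> m, \<tau> m)"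
      unfolding K using carr D that \<tau>_less by (intro diagonal_mat_mult_right[of _ d _ d]) auto
    also have "(D * P * H * P') $$ (l, \<tau> m) = (D * P * H) $$ (l, m)"
      unfolding \<tau>(2) using carr that \<tau>(1) by (intro permutation_mat_mult_right[of _ d _ d]) auto
    also have "D * P * H = D * (P * H)"
      using carr by (intro assoc_mult_mat) auto
    also have "(D * (P * H)) $$ (l, m) = D $$ (l, l) * (P * H) $$ (l, m)"
      using carr D that by (intro diagonal_mat_mult_left[of _ d _ d]) auto
    also have "(P * H) $$ (l, m) = H $$ (\<sigma> l, m)"
      unfolding \<sigma>(2) using carr that \<sigma>(1) by (intro permutation_mat_mult_left[of _ d _ d]) auto
    finally show ?thesis .
  qed
  \<comment> \<open>Rows are pulled back along \<sigma>. Columns need no preimages, because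
    \<open>K_entry\<close> reads \<open>K\<close> at column \<open>\<tau> m\<close>.\<close>
  obtain l l' where l: "l < d" "\<sigma> l = i" "l' < d" "\<sigma> l' = i'"
    using permutes_image[OF \<sigma>(1)] assms(3,4)
    by (metis (no_types, lifting) atLeastLessThan_iff imageE zero_le)
  define \<alpha> where "\<alpha> l = D $$ (l, l)" for l
  define \<beta> where "\<beta> m = D' $$ (\<tau> m, \<tau> m)" for m
  have u: "\<alpha> l * cnj (\<alpha> l) = 1" "\<alpha> l' * cnj (\<alpha> l') = 1" "\<beta> j * cnj (\<beta> j) = 1" "\<beta> j' * cnj (\<beta> j') = 1"
    unfolding \<alpha>_def \<beta>_def using unitary_diagonal_entry D l \<tau>_less assms by blast+
  have K_real: "K $$ (l, \<tau> m) \<in> {1, -1}" "K $$ (l', \<tau> m) \<in> {1, -1}" if "m < d" for m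
    using assms(1) l \<tau>_less[OF that] by (auto simp: real_hadamard_def)
  have "K $$ (l, \<tau> j) * cnj (K $$ (l', \<tau> j)) * cnj (K $$ (l, \<tau> j') * cnj (K $$ (l', \<tau> j')))
      = (\<alpha> l * cnj (\<alpha> l)) * (\<alpha> l' * cnj (\<alpha> l')) * (\<beta> j * cnj (\<beta> j)) * (\<beta> j' * cnj (\<beta> j'))
        * (row_quotient H i i' j * cnj (row_quotient H i i' j'))"
    using K_entry l assms by (simp add: row_quotient_def \<alpha>_def \<beta>_def mult_ac)
  also have "\<dots> = row_quotient H i i' j * cnj (row_quotient H i i' j')"
    by (simp add: u)
  finally show ?thesis
    using K_real[OF assms(5)] K_real[OF assms(6)] by auto
qed

text \<open>Dephasing: diagonal matrices alone turn row 0 and column 0 into ones, and each entry of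
  the resulting matrix is the cross ratio taken against row 0 and column 0. Hence it is enough to
  assume that these particular cross ratios are signs.\<close>

lemma equivalent_if_cross_ratio_real:
  assumes "complex_hadamard d H" "d > 0"
    and cr: "\<And>i j. i < d \<Longrightarrow> j < d \<Longrightarrow>
      row_quotient H i 0 j * cnj (row_quotient H i 0 0) \<in> {1, -1}"
  shows "\<exists>K. real_hadamard d K \<and> hadamard_equivalent d H K"
proof -
  define \<alpha> where "\<alpha> i = cnj (row_quotient H i 0 0)" for i
  define \<beta> where "\<beta> j = cnj (H $$ (0, j))" for j
  define D where "D = mat d d (\<lambda>(i, j). if i = j then \<alpha> i else 0)"
  define D' where "D' = mat d d (\<lambda>(i, j). if i = j then \<beta> i else 0)"
  define K where "K = D * 1\<^sub>m d * H * 1\<^sub>m d * D'"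
  have H: "H \<in> carrier_mat d d"
    using assms by (simp add: complex_hadamard_iff)
  have u: "\<alpha> i * cnj (\<alpha> i) = 1" "\<beta> i * cnj (\<beta> i) = 1" if "i < d" for i
    unfolding mult_cnj_eq_1_iff \<alpha>_def \<beta>_def complex_mod_cnj
    using assms(1,2) that norm_row_quotient[OF assms(1)] by (simp_all add: complex_hadamard_iff)
  have D: "diagonal_mat D" "unitary_mat d D" "diagonal_mat D'" "unitary_mat d D'"
    unfolding D_def D'_def using u by (auto intro!: diagonal_unitaryI)
  have carr: "D \<in> carrier_mat d d" "D' \<in> carrier_mat d d" "K \<in> carrier_mat d d"
    using H by (auto simp: D_def D'_def K_def)
  have K_eq: "K = D * H * D'"
    using carr H by (simp add: K_def)
  have K_entry: "K $$ (i, j) = \<alpha> i * H $$ (i, j) * \<beta> j" if "i < d" "j < d" for i j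
  proof -
    have "K $$ (i, j) = (D * H) $$ (i, j) * D' $$ (j, j)"
      unfolding K_eq using carr H D that by (intro diagonal_mat_mult_right[of _ d _ d]) auto
    also have "(D * H) $$ (i, j) = D $$ (i, i) * H $$ (i, j)"
      using carr H D that by (intro diagonal_mat_mult_left[of _ d _ d]) auto
    finally show ?thesis
      using that by (simp add: D_def D'_def)
  qed
  have K_real: "K $$ (i, j) \<in> {1, -1}" if "i < d" "j < d" for i j
    using cr[OF that] K_entry[OF that] by (simp add: \<alpha>_def \<beta>_def row_quotient_def mult_ac)
  have "(\<Sum>k<d. K $$ (i, k) * cnj (K $$ (i', k))) = (if i = i' then of_nat d else 0)"
    if "i < d" "i' < d" for i i'
  proof -
    \<comment> \<open>The column phase \<open>\<beta> k\<close> cancels against its conjugate in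
      every term, and the row phases do not depend on \<open>k\<close>.\<close>
    have "(\<Sum>k<d. K $$ (i, k) * cnj (K $$ (i', k)))
        = (\<Sum>k<d. \<alpha> i * cnj (\<alpha> i') * (H $$ (i, k) * cnj (H $$ (i', k))))"
    proof (rule sum.cong[OF refl])
      fix k assume "k \<in> {..<d}"
      then have k: "k < d" by simp
      have "K $$ (i, k) * cnj (K $$ (i', k))
          = \<alpha> i * cnj (\<alpha> i') * (H $$ (i, k) * cnj (H $$ (i', k))) * (\<beta> k * cnj (\<beta> k))"
        using k that by (simp add: K_entry mult_ac)
      then show "K $$ (i, k) * cnj (K $$ (i', k))
          = \<alpha> i * cnj (\<alpha> i') * (H $$ (i, k) * cnj (H $$ (i', k)))"
        using u[OF k] by simp
    qed
    also have "\<dots> = \<alpha> i * cnj (\<alpha> i') * (if i = i' then of_nat d else 0)"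
      using assms(1) that by (simp add: sum_distrib_left[symmetric] complex_hadamard_iff)
    finally show ?thesis
      using u[OF that(1)] by auto
  qed
  moreover have "cmod (K $$ (i, j)) = 1" if "i < d" "j < d" for i j
    using K_real[OF that] by auto
  ultimately have "complex_hadamard d K"
    using carr by (simp add: complex_hadamard_iff)
  then have "real_hadamard d K" "hadamard_equivalent d H K"
    unfolding real_hadamard_def hadamard_equivalent_def
    using K_real assms(1) D permutation_mat_one K_def by blast+
  then show ?thesis
    by blast
qed

section \<open>Inner products between the vectors of H(v)\<close>

lemma hadamard_vectors_eq_image:
  assumes "H \<in> carrier_mat d d"
  shows "hadamard_vectors H v
    = (\<lambda>(i, j). scale_coord j v (row H i)) ` ({..<d} \<times> {..<d})"
  using assms by (fastforce simp: hadamard_vectors_def hadamard_coord_vectors_def)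

text \<open>Scaling touches only the coordinates \<open>j\<close> and \<open>j'\<close>. The result
  is therefore the inner product of the two unscaled rows plus a correction at these
  coordinates.\<close>

lemma scale_coord_inner:
  assumes H: "complex_hadamard d H" and "i < d" "i' < d" "j < d" "j' < d"
  shows "scale_coord j v (row H i) \<bullet>c scale_coord j' v (row H i')
    = (if i = i' then of_nat d else 0) +
      (if j = j' then (of_real ((cmod v)\<^sup>2) - 1) * row_quotient H i i' j
       else (v - 1) * row_quotient H i i' j + (cnj v - 1) * row_quotient H i i' j')"
    (is "?lhs = ?rhs")
proof -
  let ?p = "row_quotient H i i'"
  have carr: "H \<in> carrier_mat d d"
    using H by (simp add: complex_hadamard_iff)
  have "?lhs = (\<Sum>k<d. (if k = j then v else 1) * (if k = j' then cnj v else 1) * ?p k)"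
    using carr assms
    by (auto simp: scale_coord_def scalar_prod_def row_quotient_def lessThan_atLeast0 intro!: sum.cong)
  \<comment> \<open>If \<open>j = j'\<close>, the whole correction is booked in the first
    conditional and the second one is 0, so nothing is counted twice.\<close>
  also have "\<dots> = (\<Sum>k<d. ?p k + (if k = j then (if j = j' then v * cnj v - 1 else v - 1) * ?p j else 0)
      + (if k = j' then (if j = j' then 0 else cnj v - 1) * ?p j' else 0))"
    by (intro sum.cong) (auto simp: algebra_simps)
  also have "\<dots> = ?rhs"
    using assms by (simp add: sum.distrib sum_row_quotient flip: complex_norm_square)
  finally show ?thesis .
qed

text \<open>The third case is the squared length of a single vector; it serves to tell lines apart.
  The last case is squared because the square depends on the two rows only through their cross
  ratio.\<close>

lemma norm_scale_coord_inner:
  fixes v :: complex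
  assumes H: "complex_hadamard d H" and "i < d" "i' < d" "j < d" "j' < d"
  defines "r \<equiv> cmod (scale_coord j v (row H i) \<bullet>c scale_coord j' v (row H i'))"
  shows "i \<noteq> i' \<Longrightarrow> j = j' \<Longrightarrow> r = \<bar>(cmod v)\<^sup>2 - 1\<bar>"
    and "i = i' \<Longrightarrow> j \<noteq> j' \<Longrightarrow> r = \<bar>real d - 2 + 2 * Re v\<bar>"
    and "i = i' \<Longrightarrow> j = j' \<Longrightarrow> r = real d + (cmod v)\<^sup>2 - 1"
    and "i \<noteq> i' \<Longrightarrow> j \<noteq> j' \<Longrightarrow> r\<^sup>2 = 2 * (cmod (v - 1))\<^sup>2
      + 2 * Re ((v - 1)\<^sup>2 * (row_quotient H i i' j * cnj (row_quotient H i i' j')))"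
proof -
  have p: "row_quotient H i i k = 1" if "k < d" for k
    using H assms that by (simp add: row_quotient_def mult_cnj_eq_1_iff complex_hadamard_iff)
  note inner = scale_coord_inner[OF assms(1-5)]
  show "r = \<bar>(cmod v)\<^sup>2 - 1\<bar>" if "i \<noteq> i'" "j = j'"
  proof -
    have "r = cmod (of_real ((cmod v)\<^sup>2 - 1))"
      unfolding r_def inner using that norm_row_quotient[OF assms(1-4)] by (simp add: norm_mult)
    then show ?thesis
      by (simp only: norm_of_real)
  qed
  show "r = \<bar>real d - 2 + 2 * Re v\<bar>" if "i = i'" "j \<noteq> j'"
  proof -
    have "r = cmod (of_real (real d - 2 + 2 * Re v))"
      unfolding r_def inner using that assms(4,5) p complex_add_cnj[of v] by (simp add: algebra_simps)
    then show ?thesis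
      by (simp only: norm_of_real)
  qed
  show "r = real d + (cmod v)\<^sup>2 - 1" if "i = i'" "j = j'"
  proof -
    have "r = cmod (of_real (real d + (cmod v)\<^sup>2 - 1))"
      unfolding r_def inner using that assms(4,5) p by (simp add: algebra_simps)
    moreover have "real d \<ge> 1"
      using assms(2) by simp
    then have "real d + (cmod v)\<^sup>2 - 1 \<ge> 0"
      using zero_le_power2[of "cmod v"] by linarith
    ultimately show ?thesis
      by (simp only: norm_of_real abs_of_nonneg)
  qed
  show "r\<^sup>2 = 2 * (cmod (v - 1))\<^sup>2
      + 2 * Re ((v - 1)\<^sup>2 * (row_quotient H i i' j * cnj (row_quotient H i i' j')))"
    if "i \<noteq> i'" "j \<noteq> j'"
  proof -
    define w x y where "w = v - 1" and "x = row_quotient H i i' j" and "y = row_quotient H i i' j'"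
    have xy: "cmod x = 1" "cmod y = 1"
      using norm_row_quotient[OF assms(1-3)] assms(4,5) by (simp_all add: x_def y_def)
    have "r\<^sup>2 = (cmod (w * x + cnj w * y))\<^sup>2"
      using that by (simp add: r_def inner w_def x_def y_def)
    also have "\<dots> = (cmod (w * x))\<^sup>2 + (cmod (cnj w * y))\<^sup>2 + 2 * Re (w * x * cnj (cnj w * y))"
      unfolding cmod_power2 by (simp add: algebra_simps power2_eq_square)
    also have "\<dots> = 2 * (cmod w)\<^sup>2 + 2 * Re (w\<^sup>2 * (x * cnj y))"
      by (simp add: norm_mult xy power2_eq_square mult_ac)
    finally show ?thesis
      by (simp add: w_def x_def y_def)
  qed
qed

section \<open>Unit complex numbers with prescribed pairwise real inner products\<close>

lemma unit_Re_eq_imp_Im: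
  assumes "cmod a = 1" "cmod b = 1" "Re a = Re b"
  shows "Im a = Im b \<or> Im a = - Im b"
proof -
  have "(Re a)\<^sup>2 + (Im a)\<^sup>2 = (Re b)\<^sup>2 + (Im b)\<^sup>2"
    using assms cmod_power2[of a] cmod_power2[of b] by simp
  then show ?thesis
    using assms(3) by (simp add: power2_eq_iff)
qed

text \<open>Relative to \<open>x 0\<close> the points \<open>x 1\<close>, \<open>x 2\<close>, \<open>x 3\<close> take at most two values, so two of them
  coincide; then the common value is 1 and all points coincide.\<close>

lemma no_planar_simplex:
  fixes x :: "nat \<Rightarrow> complex"
  assumes "d > 3" and unit: "\<And>k. k < d \<Longrightarrow> cmod (x k) = 1" and sum0: "(\<Sum>k<d. x k) = 0"
    and Re_eq: "\<And>j k. j < d \<Longrightarrow> k < d \<Longrightarrow> j \<noteq> k \<Longrightarrow> Re (x j * cnj (x k)) = t"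
  shows False
proof -
  define z where "z k = x k * cnj (x 0)" for k
  have z: "cmod (z k) = 1" if "k < d" for k
    using unit that assms(1) by (simp add: z_def norm_mult)
  have Re_z: "Re (z k) = t" if "k < d" "k \<noteq> 0" for k
    unfolding z_def using Re_eq[of k 0] that by simp
  have coincide: "t = 1" if "z j = z k" "j < d" "k < d" "j \<noteq> k" for j k
  proof -
    have "cnj (x 0) \<noteq> 0"
      using unit[of 0] assms(1) by auto
    then have "x j = x k"
      using that(1) by (simp add: z_def)
    then have "x j * cnj (x k) = 1"
      using unit[OF that(3)] by (simp add: mult_cnj_eq_1_iff)
    then show ?thesis
      using Re_eq[OF that(2,3,4)] by simp
  qed
  \<comment> \<open>Here \<open>d > 3\<close> provides three indices besides 0 for the pigeonhole
    argument. The cube roots of unity show that the statement fails for three points.\<close>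
  have "Im (z 1) = Im (z 2) \<or> Im (z 1) = - Im (z 2)" "Im (z 1) = Im (z 3) \<or> Im (z 1) = - Im (z 3)"
    using assms(1) z Re_z unit_Re_eq_imp_Im[of "z 1" "z 2"] unit_Re_eq_imp_Im[of "z 1" "z 3"]
    by simp_all
  then have "z 1 = z 2 \<or> z 1 = z 3 \<or> z 2 = z 3"
    using assms(1) Re_z[of 1] Re_z[of 2] Re_z[of 3] by (auto simp: complex_eq_iff)
  then have "t = 1"
    using coincide[of 1 2] coincide[of 1 3] coincide[of 2 3] assms(1) by auto
  moreover have "z 0 = 1"
    using unit[of 0] assms(1) by (simp add: z_def mult_cnj_eq_1_iff)
  ultimately have "Re (z k) = 1" if "k < d" for k
    using Re_z[OF that] by (cases "k = 0") auto
  \<comment> \<open>Rotation by \<open>cnj (x 0)\<close> keeps the sum equal to 0, yet all real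
    parts are now 1.\<close>
  then have "(\<Sum>k<d. Re (z k)) = real d"
    by simp
  moreover have "(\<Sum>k<d. Re (z k)) = Re ((\<Sum>k<d. x k) * cnj (x 0))"
    by (simp only: z_def sum_distrib_right Re_sum)
  ultimately show False
    using sum0 assms(1) by simp
qed

text \<open>If one sign were missing, all pairwise real inner products would agree, against
  \<open>no_planar_simplex\<close>.\<close>

lemma signs_both_occur:
  fixes x :: "nat \<Rightarrow> complex"
  assumes "d > 3" and unit: "\<And>k. k < d \<Longrightarrow> cmod (x k) = 1" and sum0: "(\<Sum>k<d. x k) = 0"
    and sign: "\<And>j k. j < d \<Longrightarrow> k < d \<Longrightarrow> j \<noteq> k \<Longrightarrow> x j * cnj (x k) \<in> {1, -1}"
  shows "\<exists>j<d. \<exists>k<d. j \<noteq> k \<and> x j * cnj (x k) = 1" "\<exists>j<d. \<exists>k<d. j \<noteq> k \<and> x j * cnj (x k) = -1"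
proof -
  show plus: "\<exists>j<d. \<exists>k<d. j \<noteq> k \<and> x j * cnj (x k) = 1"
  proof (rule ccontr)
    assume "\<not> ?thesis"
    then have "x j * cnj (x k) = -1" if "j < d" "k < d" "j \<noteq> k" for j k
      using sign[OF that] that by blast
    then show False
      using no_planar_simplex[OF assms(1) unit sum0, of "-1"] by simp
  qed
  show "\<exists>j<d. \<exists>k<d. j \<noteq> k \<and> x j * cnj (x k) = -1"
  proof (rule ccontr)
    assume "\<not> ?thesis"
    then have "x j * cnj (x k) = 1" if "j < d" "k < d" "j \<noteq> k" for j k
      using sign[OF that] that by blast
    then show False
      using no_planar_simplex[OF assms(1) unit sum0, of "1"] by simp
  qed
qed

lemma unit_real_sign:
  assumes "cmod z = 1" "Im z = 0"
  shows "z \<in> {1, -1}"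
proof -
  have "(Re z)\<^sup>2 = 1"
    using assms cmod_power2[of z] by simp
  then show ?thesis
    using assms(2) by (auto simp: power2_eq_1_iff complex_eq_iff)
qed

text \<open>This is the equality case of Cauchy-Schwarz. It is applied in contrapositive form, to
  show that vectors with a small inner product span distinct lines.\<close>

lemma norm_eq_if_same_line:
  assumes x: "x \<in> carrier_vec d" and y: "y \<in> carrier_vec d"
    and line: "complex_line x = complex_line y"
  shows "(cmod (x \<bullet>c y))\<^sup>2 = cmod (x \<bullet>c x) * cmod (y \<bullet>c y)"
proof -
  have "1 \<cdot>\<^sub>v y \<in> complex_line y"
    unfolding complex_line_def by blast
  then obtain a where a: "y = a \<cdot>\<^sub>v x"
    using line by (auto simp: complex_line_def)
  have "conjugate y = cnj a \<cdot>\<^sub>v conjugate x"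
    using a by (simp add: conjugate_smult_vec)
  then show ?thesis
    using x by (simp add: a norm_mult power2_eq_square)
qed

section \<open>Necessity: what equiangularity forces on d, H and v\<close>

lemma equiangular_imp:
  assumes "d > 3" and H: "complex_hadamard d H"
    and eq: "equiangular_lines d (d\<^sup>2) (hadamard_vectors H v)"
  shows "d = 8" "\<exists>K. real_hadamard d K \<and> hadamard_equivalent d H K"
    "v \<in> {-1 + 2 * \<i>, -1 - 2 * \<i>}"
proof -
  define u where "u i j = scale_coord j v (row H i)" for i j
  define w where "w = v - 1"
  define x where "x = row_quotient H"
  have S: "hadamard_vectors H v = (\<lambda>(i, j). u i j) ` ({..<d} \<times> {..<d})"
    unfolding u_def using H by (intro hadamard_vectors_eq_image) (simp add: complex_hadamard_iff)
  \<comment> \<open>The cardinality condition says that the d^2 index pairs give d^2 vectors. So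
    distinct index pairs give distinct vectors, and the common modulus \<open>c\<close> applies to
    them.\<close>
  have "inj_on (\<lambda>(i, j). u i j) ({..<d} \<times> {..<d})"
    using eq by (intro eq_card_imp_inj_on)
      (auto simp: equiangular_lines_def S[symmetric] power2_eq_square)
  then have u_neq: "u i j \<noteq> u i' j'"
    if "i < d" "i' < d" "j < d" "j' < d" "(i, j) \<noteq> (i', j')" for i j i' j'
    using that inj_onD[of _ _ "(i, j)" "(i', j')"] by fastforce
  obtain c where c: "\<And>a b. a \<in> hadamard_vectors H v \<Longrightarrow> b \<in> hadamard_vectors H v \<Longrightarrow> a \<noteq> b
      \<Longrightarrow> cmod (a \<bullet>c b) = c"
    using eq by (auto simp: equiangular_lines_def)
  have uc: "cmod (u i j \<bullet>c u i' j') = c"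
    if "i < d" "i' < d" "j < d" "j' < d" "(i, j) \<noteq> (i', j')" for i j i' j'
    using that u_neq[OF that] by (intro c) (auto simp: S)
  have c1: "c = \<bar>(cmod v)\<^sup>2 - 1\<bar>"
    using uc[of 0 1 0 0] norm_scale_coord_inner(1)[OF H, of 0 1 0 0 v] assms(1) by (simp add: u_def)
  have c2: "c = \<bar>real d - 2 + 2 * Re v\<bar>"
    using uc[of 0 0 0 1] norm_scale_coord_inner(2)[OF H, of 0 0 0 1 v] assms(1) by (simp add: u_def)
  have c3: "c\<^sup>2 = 2 * (cmod w)\<^sup>2 + 2 * Re (w\<^sup>2 * (x i i' j * cnj (x i i' j')))"
    if "i < d" "i' < d" "j < d" "j' < d" "i \<noteq> i'" "j \<noteq> j'" for i i' j j'
    using uc[of i i' j j'] norm_scale_coord_inner(4)[OF H, of i i' j j' v] that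
    by (simp add: u_def w_def x_def)
  have unit: "cmod (x i i' j) = 1" if "i < d" "i' < d" "j < d" for i i' j
    unfolding x_def using norm_row_quotient[OF H] that by blast
  have sum0: "(\<Sum>k<d. x 0 1 k) = 0"
    unfolding x_def using sum_row_quotient[OF H, of 0 1] assms(1) by simp
  text \<open>Interchanging \<open>j\<close> and \<open>j'\<close> conjugates the cross ratio, which separates real and imaginary parts.\<close>
  have sep: "Im (w\<^sup>2) * Im (x i i' j * cnj (x i i' j')) = 0"
    "2 * Re (w\<^sup>2) * Re (x i i' j * cnj (x i i' j')) = c\<^sup>2 - 2 * (cmod w)\<^sup>2"
    if "i < d" "i' < d" "j < d" "j' < d" "i \<noteq> i'" "j \<noteq> j'" for i i' j j'
  proof -
    define z where "z = x i i' j * cnj (x i i' j')"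
    have cnj_z: "x i i' j' * cnj (x i i' j) = cnj z"
      by (simp add: z_def)
    have "c\<^sup>2 = 2 * (cmod w)\<^sup>2 + 2 * Re (w\<^sup>2 * z)" "c\<^sup>2 = 2 * (cmod w)\<^sup>2 + 2 * Re (w\<^sup>2 * cnj z)"
      using c3[OF that, folded z_def] c3[OF that(1,2,4,3,5) that(6)[symmetric], unfolded cnj_z]
      by blast+
    moreover have "Re (w\<^sup>2 * z) = Re (w\<^sup>2) * Re z - Im (w\<^sup>2) * Im z"
      "Re (w\<^sup>2 * cnj z) = Re (w\<^sup>2) * Re z + Im (w\<^sup>2) * Im z"
      by simp_all
    ultimately show "Im (w\<^sup>2) * Im (x i i' j * cnj (x i i' j')) = 0"
      "2 * Re (w\<^sup>2) * Re (x i i' j * cnj (x i i' j')) = c\<^sup>2 - 2 * (cmod w)\<^sup>2"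
      unfolding z_def[symmetric] by linarith+
  qed
  \<comment> \<open>For \<open>v = 1\<close>, \<open>c1\<close> gives c = 0 whereas
    \<open>c2\<close> gives c = d.\<close>
  have "w \<noteq> 0"
  proof
    assume "w = 0"
    then have "v = 1" by (simp add: w_def)
    then show False
      using c1 c2 assms(1) by simp
  qed
  have Im_w: "Im (w\<^sup>2) \<noteq> 0"
  proof
    assume "Im (w\<^sup>2) = 0"
    then have Re_w: "Re (w\<^sup>2) \<noteq> 0"
      using \<open>w \<noteq> 0\<close> by (metis complex_eq_iff power_not_zero zero_complex.sel)
    have "Re (x 0 1 j * cnj (x 0 1 k)) = (c\<^sup>2 - 2 * (cmod w)\<^sup>2) / (2 * Re (w\<^sup>2))"
      if "j < d" "k < d" "j \<noteq> k" for j k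
      using sep(2)[of 0 1 j k] that assms(1) Re_w by (simp add: field_simps)
    then show False
      using no_planar_simplex[of d "x 0 1", OF assms(1) _ sum0] unit assms(1) by force
  qed
  have sign: "x i i' j * cnj (x i i' j') \<in> {1, -1}"
    if "i < d" "i' < d" "j < d" "j' < d" "i \<noteq> i'" "j \<noteq> j'" for i i' j j'
    using sep(1)[OF that] Im_w unit that by (intro unit_real_sign) (auto simp: norm_mult)
  have "\<exists>j<d. \<exists>k<d. j \<noteq> k \<and> x 0 1 j * cnj (x 0 1 k) = 1"
    "\<exists>j<d. \<exists>k<d. j \<noteq> k \<and> x 0 1 j * cnj (x 0 1 k) = -1"
    using assms(1) by (intro signs_both_occur sum0 sign unit; simp)+
  then obtain j k j' k' where jk: "j < d" "k < d" "j \<noteq> k" "x 0 1 j * cnj (x 0 1 k) = 1"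
    and jk': "j' < d" "k' < d" "j' \<noteq> k'" "x 0 1 j' * cnj (x 0 1 k') = -1"
    by blast
  \<comment> \<open>A cross ratio 1 and a cross ratio -1 give the same right-hand side with opposite
    left-hand sides, so both sides vanish.\<close>
  have "2 * Re (w\<^sup>2) = c\<^sup>2 - 2 * (cmod w)\<^sup>2" "- 2 * Re (w\<^sup>2) = c\<^sup>2 - 2 * (cmod w)\<^sup>2"
    using sep(2)[of 0 1 j k, unfolded jk] sep(2)[of 0 1 j' k', unfolded jk'] jk jk' assms(1)
    by simp_all
  then have Re_w: "Re (w\<^sup>2) = 0" and c_sq: "c\<^sup>2 = 2 * (cmod w)\<^sup>2"
    by linarith+
  define a b where "a = Re w" and "b = Im w"
  have ab: "a\<^sup>2 = b\<^sup>2"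
    using Re_w by (simp add: a_def b_def power2_eq_square)
  have v: "Re v = 1 + a" "Im v = b"
    by (simp_all add: a_def b_def w_def)
  have "a \<noteq> 0"
    using ab \<open>w \<noteq> 0\<close> by (auto simp: a_def b_def complex_eq_iff)
  have "c\<^sup>2 = 4 * a\<^sup>2"
    using c_sq ab by (simp add: cmod_power2 a_def b_def)
  \<comment> \<open>Since a^2 = b^2, |v|^2 - 1 = (1 + a)^2 + a^2 - 1 = 2a(a + 1). Comparison with
    c^2 = 4a^2 leaves (a + 1)^2 = 1, whose root a = 0 is excluded.\<close>
  moreover have "c\<^sup>2 = (2 * a * (a + 1))\<^sup>2"
  proof -
    have "(cmod v)\<^sup>2 - 1 = 2 * a * (a + 1)"
      unfolding cmod_power2 v ab[symmetric] by (simp add: algebra_simps power2_eq_square)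
    then show ?thesis
      using c1 by simp
  qed
  ultimately have "(a + 1)\<^sup>2 = 1"
    using \<open>a \<noteq> 0\<close> by (simp add: power_mult_distrib)
  then have a: "a = -2"
    using \<open>a \<noteq> 0\<close> by (auto simp: power2_eq_1_iff)
  then have "b\<^sup>2 = 2\<^sup>2"
    using ab by simp
  then have "b = 2 \<or> b = -2"
    by (simp only: power2_eq_iff)
  then show "v \<in> {-1 + 2 * \<i>, -1 - 2 * \<i>}"
    using v a by (auto simp: complex_eq_iff)
  have "c\<^sup>2 = 4\<^sup>2" "c \<ge> 0"
    using \<open>c\<^sup>2 = 4 * a\<^sup>2\<close> a c1 by simp_all
  then have "c = 4"
    by (simp only: power2_eq_iff_nonneg zero_le_numeral)
  \<comment> \<open>With Re v = -1, \<open>c2\<close> reads 4 = |d - 4|; the solution d = 0 is ruled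
    out by \<open>d > 3\<close>.\<close>
  then show "d = 8"
    using c2 v a assms(1) by simp
  show "\<exists>K. real_hadamard d K \<and> hadamard_equivalent d H K"
  proof (rule equivalent_if_cross_ratio_real[OF H])
    show "d > 0"
      using assms(1) by simp
    fix i j assume ij: "i < d" "j < d"
    show "row_quotient H i 0 j * cnj (row_quotient H i 0 0) \<in> {1, -1}"
    \<comment> \<open>\<open>sign\<close> speaks only of distinct rows and distinct columns. In row
      0 and column 0 the cross ratio is 1.\<close>
    proof (cases "i = 0 \<or> j = 0")
      case True
      have "row_quotient H i 0 j * cnj (row_quotient H i 0 0) = 1"
      proof (cases "j = 0")
        case True
        then show ?thesis
          using norm_row_quotient[OF H, of i 0 0] ij assms(1) by (simp add: mult_cnj_eq_1_iff)
      next
        case False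
        then have "i = 0" using True by simp
        moreover have "row_quotient H 0 0 k = 1" if "k < d" for k
          using H that ij by (simp add: row_quotient_def mult_cnj_eq_1_iff complex_hadamard_iff)
        ultimately show ?thesis
          using ij by simp
      qed
      then show ?thesis by simp
    next
      case False
      then show ?thesis
        using sign[of i 0 j 0] ij by (simp add: x_def)
    qed
  qed
qed

section \<open>Sufficiency: equiangularity in dimension 8\<close>

lemma real_hadamard_equiangular:
  assumes H: "complex_hadamard 8 H" and K: "real_hadamard 8 K" "hadamard_equivalent 8 H K"
    and v: "v \<in> {-1 + 2 * \<i>, -1 - 2 * \<i>}"
  shows "equiangular_lines 8 (8\<^sup>2) (hadamard_vectors H v)"
proof -
  define u where "u = (\<lambda>(i, j). scale_coord j v (row H i))"
  define I where "I = {..<8::nat} \<times> {..<8::nat}"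
  have S: "hadamard_vectors H v = u ` I"
    unfolding u_def I_def using H
    by (intro hadamard_vectors_eq_image) (simp add: complex_hadamard_iff)
  \<comment> \<open>These values bring all three moduli to 4: 5 - 1 = 4, 8 - 2 - 2 = 4, and 2 * 8 =
    4^2. In the last one the cross term vanishes, as (v - 1)^2 is purely imaginary and the cross
    ratio is real.\<close>
  have v': "(cmod v)\<^sup>2 = 5" "Re v = -1" "(cmod (v - 1))\<^sup>2 = 8" "Re ((v - 1)\<^sup>2) = 0"
    using v unfolding cmod_power2 by (auto simp: power2_eq_square)
  \<comment> \<open>The squared length is d + |v|^2 - 1 = 8 + 5 - 1.\<close>
  have self: "cmod (u p \<bullet>c u p) = 12" if "p \<in> I" for p
    using that norm_scale_coord_inner(3)[OF H, of "fst p" "fst p" "snd p" "snd p" v] v'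
    by (auto simp: u_def I_def)
  have distinct: "cmod (u p \<bullet>c u q) = 4" if pq: "p \<in> I" "q \<in> I" "p \<noteq> q" for p q
  proof -
    obtain i j i' j' where p: "p = (i, j)" "q = (i', j')"
      by (metis surj_pair)
    then have less: "i < 8" "i' < 8" "j < 8" "j' < 8"
      using pq by (auto simp: I_def)
    consider "i \<noteq> i'" "j = j'" | "i = i'" "j \<noteq> j'" | "i \<noteq> i'" "j \<noteq> j'"
      using pq p by auto
    then show ?thesis
    proof cases
      case 1
      then show ?thesis
        using norm_scale_coord_inner(1)[OF H less] v' by (simp add: u_def p)
    next
      case 2
      then show ?thesis
        using norm_scale_coord_inner(2)[OF H less] v' by (simp add: u_def p)
    next
      case 3
      define z where "z = row_quotient H i i' j * cnj (row_quotient H i i' j')"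
      have "z \<in> {1, -1}"
        unfolding z_def by (rule cross_ratio_real_if_equivalent[OF K less])
      then have "Re ((v - 1)\<^sup>2 * z) = 0"
        using v'(4) by auto
      then have "(cmod (u p \<bullet>c u q))\<^sup>2 = 4\<^sup>2"
        using norm_scale_coord_inner(4)[OF H less 3, of v, folded z_def] v'(3) by (simp add: u_def p)
      then show ?thesis
        by (simp only: power2_eq_iff_nonneg norm_ge_zero zero_le_numeral)
    qed
  qed
  have carr: "u p \<in> carrier_vec 8" for p
    using H by (auto simp: u_def scale_coord_def complex_hadamard_iff split: prod.split)
  \<comment> \<open>On a common line \<open>norm_eq_if_same_line\<close> would give 4^2 = 12 * 12.
    As equal vectors span equal lines, this one fact yields injectivity of \<open>u\<close> as well
    as of \<open>complex_line\<close> on its image.\<close>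
  have line: "p = q" if "p \<in> I" "q \<in> I" "complex_line (u p) = complex_line (u q)" for p q
  proof (rule ccontr)
    assume "p \<noteq> q"
    then show False
      using norm_eq_if_same_line[OF carr carr that(3)] self that distinct by simp
  qed
  have "inj_on u I"
    using line by (auto intro!: inj_onI)
  then have "card (u ` I) = 8\<^sup>2"
    by (simp add: card_image I_def)
  moreover have "inj_on complex_line (u ` I)"
    using line by (auto intro!: inj_onI)
  moreover have "0\<^sub>v 8 \<notin> u ` I"
  proof
    assume "0\<^sub>v 8 \<in> u ` I"
    then obtain p where "p \<in> I" "u p = 0\<^sub>v 8"
      by auto
    then show False
      using self[of p] by simp
  qed
  moreover have "\<forall>x\<in>u ` I. \<forall>y\<in>u ` I. x \<noteq> y \<longrightarrow> cmod (x \<bullet>c y) = 4"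
    using distinct by blast
  moreover have "u ` I \<subseteq> carrier_vec 8" "finite (u ` I)"
    using carr by (auto simp: I_def)
  ultimately show ?thesis
    unfolding equiangular_lines_def S by blast
qed

theorem theorem3p5:
  fixes d :: nat and H :: "complex mat" and v :: complex
  assumes "d > 3"
    and "complex_hadamard d H"
  shows "equiangular_lines d (d\<^sup>2) (hadamard_vectors H v) \<longleftrightarrow>
           d = 8 \<and> (\<exists>K. real_hadamard d K \<and> hadamard_equivalent d H K) \<and>
           v \<in> {-1 + 2 * \<i>, -1 - 2 * \<i>}"
  using equiangular_imp[OF assms] real_hadamard_equiangular assms(2) by blast

end
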